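(* Let $T$ be the set of nonzero binary cubics $P\in S^3((k^2)^* )$ having a triple root, and let $Z_\mu=\{P\in S^3((k^2)^* ): P\neq 0 \text{ and } \mu(P)=0\}$. Then $T=Z_\mu$.
   Context: $k$ is a field of characteristic different from $2$ and $3$; $x,y$ is the standard coordinate basis of $(k^2)^*$; $S^3((k^2)^* )=\{ax^3+3bx^2y+3cxy^2+dy^3: a,b,c,d\in k\}$ is the space of binary cubics. The moment map $\mu:S^3((k^2)^* )\to\mathfrak{sl}(2,k)$ is $$\mu(ax^3+3bx^2y+3cxy^2+dy^3)=\begin{pmatrix} ad-bc & 2(bd-c^2)\\ 2(b^2-ac) & -(ad-bc)\end{pmatrix}.$$ A nonzero binary cubic $P$ has a triple root if $P=\lambda\phi^3$ for some $\lambda\in k^*$ and some nonzero linear form $\phi\in (k^2)^*$. *)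

theory Defs
  imports "HOL-Analysis.Analysis" "HOL-Computational_Algebra.Polynomial"
begin

text \<open>
  The symmetric algebra of the dual of \<open>k\<^sup>2\<close> is the polynomial ring \<open>k[x,y]\<close>, realised here as
  \<open>k[x][y]\<close>, i.e. by the type \<open>'a poly poly\<close>. The inner variable is \<open>x\<close> and the outer one is \<open>y\<close>,
  so that the coefficient of \<open>x^i y^j\<close> in \<open>P\<close> is \<open>coeff (coeff P j) i\<close>. Elements of the field are
  embedded as \<open>[:[:c:]:]\<close>.
\<close>

definition X :: "'a::field poly poly" where
  "X = [:[:0, 1:]:]"

definition Y :: "'a::field poly poly" where
  "Y = [:0, 1:]"

definition linear_form :: "'a::field \<Rightarrow> 'a \<Rightarrow> 'a poly poly" where
  "linear_form p q = [:[:p:]:] * X + [:[:q:]:] * Y"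

definition linear_forms :: "'a::field poly poly set" where
  "linear_forms = {linear_form p q | p q. True}"

definition binary_cubic :: "'a::field \<Rightarrow> 'a \<Rightarrow> 'a \<Rightarrow> 'a \<Rightarrow> 'a poly poly" where
  "binary_cubic a b c d =
     [:[:a:]:] * X ^ 3 + 3 * [:[:b:]:] * X ^ 2 * Y + 3 * [:[:c:]:] * X * Y ^ 2 + [:[:d:]:] * Y ^ 3"

definition binary_cubics :: "'a::field poly poly set" where
  "binary_cubics = {binary_cubic a b c d | a b c d. True}"

definition sl2 :: "('a::field ^ 2 ^ 2) set" where
  "sl2 = {A. trace A = 0}"

text \<open>
  The parameters \<open>a, b, c, d\<close> of a binary cubic are recovered from its coefficients; the divisions
  by 3 undo the binomial factors. The resulting formula in terms of the parameters is the lemma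
  \<open>moment_map_binary_cubic\<close> below.
\<close>

definition moment_map :: "'a::field poly poly \<Rightarrow> 'a ^ 2 ^ 2" where
  "moment_map P =
     (let a = coeff (coeff P 0) 3;
          b = coeff (coeff P 1) 2 / 3;
          c = coeff (coeff P 2) 1 / 3;
          d = coeff (coeff P 3) 0
      in vector [vector [a * d - b * c, 2 * (b * d - c ^ 2)],
                 vector [2 * (b ^ 2 - a * c), - (a * d - b * c)]])"

lemma binary_cubic_explicit:
  "binary_cubic a b c d = [:[:0, 0, 0, a:], [:0, 0, 3 * b:], [:0, 3 * c:], [:d:]:]"
  by (simp add: binary_cubic_def X_def Y_def power2_eq_square power3_eq_cube numeral_poly)

lemma three_neq_0_if_CHAR: 
  assumes "CHAR('a::field) \<noteq> 3"
  shows "(3 :: 'a) \<noteq> 0"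
proof
  assume "(3 :: 'a) = 0"
  hence "of_nat 3 = (0 :: 'a)" by simp
  hence "CHAR('a) dvd 3" by (simp only: of_nat_eq_0_iff_char_dvd)
  moreover have "prime (3 :: nat)" by (simp add: prime_nat_numeral_eq)
  ultimately have "CHAR('a) = 1" using assms by (auto simp: prime_nat_iff)
  thus False by simp
qed

lemma moment_map_binary_cubic:
  fixes a b c d :: "'a::field"
  assumes "CHAR('a) \<noteq> 3"
  shows "moment_map (binary_cubic a b c d) =
     vector [vector [a * d - b * c, 2 * (b * d - c ^ 2)],
             vector [2 * (b ^ 2 - a * c), - (a * d - b * c)]]"
  using three_neq_0_if_CHAR[OF assms]
  by (simp add: moment_map_def binary_cubic_explicit numeral_2_eq_2 numeral_3_eq_3)

lemma moment_map_in_sl2: "moment_map P \<in> sl2"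
  by (simp add: moment_map_def sl2_def trace_def sum_2 Let_def)

definition has_triple_root :: "'a::field poly poly \<Rightarrow> bool" where
  "has_triple_root P \<longleftrightarrow>
     (\<exists>l \<phi>. l \<noteq> 0 \<and> \<phi> \<in> linear_forms \<and> \<phi> \<noteq> 0 \<and> P = [:[:l:]:] * \<phi> ^ 3)"

definition triple_root_cubics :: "'a::field poly poly set" where
  "triple_root_cubics = {P \<in> binary_cubics. P \<noteq> 0 \<and> has_triple_root P}"

definition moment_zeros :: "'a::field poly poly set" where
  "moment_zeros = {P \<in> binary_cubics. P \<noteq> 0 \<and> moment_map P = 0}"

end

theory Submission
  imports Defs
begin

text \<open>
  In characteristic different from 2 and 3, the vanishing of the moment map of
  \<open>a x\<^sup>3 + 3 b x\<^sup>2 y + 3 c x y\<^sup>2 + d y\<^sup>3\<close> says that the matrix with rows \<open>(a, b, c)\<close> and \<open>(b, c, d)\<close> has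
  vanishing \<open>2 \<times> 2\<close> minors, i.e. that \<open>a, b, c, d\<close> is a geometric progression in the homogeneous
  sense. These are the equations of the affine cone over the twisted cubic, whose points are
  the multiples \<open>(l p\<^sup>3, l p\<^sup>2 q, l p q\<^sup>2, l q\<^sup>3)\<close>; and those are the parameters of \<open>l (p x + q y)\<^sup>3\<close>.
  The lemmas \<open>moment_map_eq_0_iff\<close>, \<open>twisted_cubic_cone\<close> and \<open>smult_cube_linear_form\<close> carry these
  three steps.
\<close>

lemma two_neq_0_if_CHAR:
  assumes "CHAR('a::field) \<noteq> 2"
  shows "(2 :: 'a) \<noteq> 0"
proof
  assume "(2 :: 'a) = 0"
  hence "of_nat 2 = (0 :: 'a)" by simp
  hence "CHAR('a) dvd 2" by (simp only: of_nat_eq_0_iff_char_dvd)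
  hence "CHAR('a) = 1" using assms two_is_prime_nat by (auto simp: prime_nat_iff)
  thus False by simp
qed

lemma moment_map_eq_0_iff:
  fixes a b c d :: "'a::field"
  assumes "CHAR('a) \<noteq> 2" and "CHAR('a) \<noteq> 3"
  shows "moment_map (binary_cubic a b c d) = 0 \<longleftrightarrow> a * d = b * c \<and> b * d = c ^ 2 \<and> b ^ 2 = a * c"
  using two_neq_0_if_CHAR[OF assms(1)]
  by (auto simp: moment_map_binary_cubic[OF assms(2)] vec_eq_iff forall_2)

text \<open>
  The binomial factors 3 built into the parameters of a binary cubic absorb those of the expanded
  cube, which leaves the standard parametrisation of the twisted cubic on the right.
\<close>

lemma smult_cube_linear_form:
  "[:[:l:]:] * linear_form p q ^ 3 =
     binary_cubic (l * p ^ 3) (l * p ^ 2 * q) (l * p * q ^ 2) (l * q ^ 3)"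
  by (simp add: binary_cubic_explicit linear_form_def X_def Y_def power2_eq_square
      power3_eq_cube algebra_simps)

lemma linear_form_eq_0_iff: "linear_form p q = 0 \<longleftrightarrow> p = 0 \<and> q = 0"
  by (auto simp: linear_form_def X_def Y_def)

text \<open>
  If \<open>a \<noteq> 0\<close>, the progression has ratio \<open>b / a\<close>, which puts the root at \<open>x + (b / a) y\<close>. If \<open>a = 0\<close>,
  then \<open>b\<^sup>2 = 0\<close> and hence \<open>c\<^sup>2 = 0\<close>, and only the point at infinity of the curve remains, with
  cubic \<open>d y\<^sup>3\<close>.
\<close>

lemma twisted_cubic_cone:
  fixes a b c d :: "'a::field"
  assumes "a * d = b * c" and "b * d = c ^ 2" and "b ^ 2 = a * c"
  obtains l p q where "p \<noteq> 0 \<or> q \<noteq> 0"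
    and "a = l * p ^ 3" and "b = l * p ^ 2 * q" and "c = l * p * q ^ 2" and "d = l * q ^ 3"
proof (cases "a = 0")
  case True
  hence "b = 0" using assms(3) by simp
  moreover from this have "c = 0" using assms(2) by simp
  ultimately show ?thesis using True by (intro that[of 0 1 d]) simp_all
next
  case False
  hence c: "c = b ^ 2 / a" using assms(3) by simp
  have "d = b * c / a" using False assms(1) by (simp add: field_simps)
  hence "d = b ^ 3 / a ^ 2" by (simp add: c power2_eq_square power3_eq_cube)
  with c False show ?thesis
    by (intro that[of 1 "b / a" a]) (simp_all add: power2_eq_square power3_eq_cube)
qed

theorem proposition3p3:
  assumes "CHAR('a::field) \<noteq> 2" and "CHAR('a) \<noteq> 3"
  shows "(triple_root_cubics :: 'a poly poly set) = moment_zeros"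
proof (intro equalityI subsetI)
  fix P :: "'a poly poly"
  assume "P \<in> triple_root_cubics"
  then obtain l p q where P: "P \<in> binary_cubics" "P \<noteq> 0" "P = [:[:l:]:] * linear_form p q ^ 3"
    unfolding triple_root_cubics_def has_triple_root_def linear_forms_def by blast
  have "moment_map P = 0"
    unfolding P(3) smult_cube_linear_form moment_map_eq_0_iff[OF assms]
    by (simp add: power2_eq_square power3_eq_cube)
  with P(1,2) show "P \<in> moment_zeros" by (simp add: moment_zeros_def)
next
  fix P :: "'a poly poly"
  assume "P \<in> moment_zeros"
  then obtain a b c d where P: "P \<in> binary_cubics" "P \<noteq> 0" "P = binary_cubic a b c d"
    and "moment_map (binary_cubic a b c d) = 0"
    unfolding moment_zeros_def binary_cubics_def by blast
  hence "a * d = b * c" "b * d = c ^ 2" "b ^ 2 = a * c"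
    by (simp_all add: moment_map_eq_0_iff[OF assms])
  then obtain l p q where pq: "p \<noteq> 0 \<or> q \<noteq> 0"
    and "a = l * p ^ 3" "b = l * p ^ 2 * q" "c = l * p * q ^ 2" "d = l * q ^ 3"
    by (rule twisted_cubic_cone)
  hence cube: "P = [:[:l:]:] * linear_form p q ^ 3"
    by (simp only: P(3) smult_cube_linear_form)
  have "l \<noteq> 0" using P(2) cube by auto
  moreover have "linear_form p q \<in> linear_forms" by (auto simp: linear_forms_def)
  moreover have "linear_form p q \<noteq> 0" using pq by (simp add: linear_form_eq_0_iff)
  ultimately have "has_triple_root P"
    unfolding has_triple_root_def using cube by blast
  with P(1,2) show "P \<in> triple_root_cubics" by (simp add: triple_root_cubics_def)
qed

end
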